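(* There exists $N_0$ such that the following holds. Let $q\ge1$ and $r$ be integers with $1\le r\le 0.6q$ and let $n=q^2+q+1+r\ge N_0$ (so $n\in\{q^2+q+2,\dots,(q+1)^2\}$). Then $$\mathrm{ex}(n,C_4)=\mathrm{ex}(q^2+q+1+r,C_4)\le \frac12\big(q^2+q+1+\max\{r,\,2r-0.3q\}\big)(q+1).$$
   Context: $\mathrm{ex}(n,C_4)$ denotes the maximum number of edges in an $n$-vertex simple graph containing no cycle of length four as a subgraph. *)

theory Defs
  imports Complex_Main
begin

text \<open>A graph is a pair of a vertex set and a set of edges, the edges being two-element sets of
  vertices, so that loops and multiple edges are excluded.\<close>

type_synonym 'a graph = "'a set \<times> 'a set set"

abbreviation verts :: "'a graph \<Rightarrow> 'a set" where "verts \<equiv> fst"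
abbreviation edges :: "'a graph \<Rightarrow> 'a set set" where "edges \<equiv> snd"

definition simple_graph :: "'a graph \<Rightarrow> bool" where
  "simple_graph G \<longleftrightarrow> finite (verts G) \<and> (\<forall>e\<in>edges G. e \<subseteq> verts G \<and> card e = 2)"

text \<open>\<open>contains_copy G H\<close>: some (not necessarily induced) subgraph of \<open>G\<close> is isomorphic to \<open>H\<close>.\<close>

definition contains_copy :: "'a graph \<Rightarrow> 'b graph \<Rightarrow> bool" where
  "contains_copy G H \<longleftrightarrow>
     (\<exists>f. inj_on f (verts H) \<and> f ` verts H \<subseteq> verts G \<and> (\<forall>e\<in>edges H. f ` e \<in> edges G))"

text \<open>Meaningful for \<open>k \<ge> 3\<close> only.\<close>

definition cycle_graph :: "nat \<Rightarrow> nat graph" where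
  "cycle_graph k = ({..<k}, {{i, Suc i mod k} | i. i < k})"

text \<open>The vertices range over the natural numbers, which loses nothing: see
  \<open>card_edges_le_extremal_number\<close> below for graphs over arbitrary types.  The maximum is taken
  over a finite set, and a nonempty one as soon as \<open>H\<close> has an edge; see
  \<open>finite_edge_counts\<close> and \<open>edge_counts_nonempty\<close>.\<close>

definition extremal_number :: "nat \<Rightarrow> 'b graph \<Rightarrow> nat" where
  "extremal_number n H =
     Max {card (edges G) | G :: nat graph.
            simple_graph G \<and> card (verts G) = n \<and> \<not> contains_copy G H}"

lemma finite_edge_counts:
  "finite {card (edges G) | G :: nat graph.
            simple_graph G \<and> card (verts G) = n \<and> \<not> contains_copy G H}"
proof (rule finite_subset)
  show "{card (edges G) | G :: nat graph.
          simple_graph G \<and> card (verts G) = n \<and> \<not> contains_copy G H} \<subseteq> {..2 ^ n}"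
  proof clarsimp
    fix V :: "nat set" and E :: "nat set set"
    assume g: "simple_graph (V, E)" and n: "n = card V"
    have "E \<subseteq> Pow V" and "finite V"
      using g by (auto simp: simple_graph_def)
    then have "card E \<le> card (Pow V)"
      by (intro card_mono) auto
    then show "card E \<le> 2 ^ card V"
      using \<open>finite V\<close> by (simp add: card_Pow)
  qed
qed simp

lemma edge_counts_nonempty:
  assumes "edges H \<noteq> {}"
  shows "{card (edges G) | G :: nat graph.
            simple_graph G \<and> card (verts G) = n \<and> \<not> contains_copy G H} \<noteq> {}"
proof -
  have "simple_graph ({..<n}, {}) \<and> card (verts ({..<n}, {} :: nat set set)) = n
          \<and> \<not> contains_copy ({..<n}, {}) H"
    using assms by (auto simp: simple_graph_def contains_copy_def)
  then show ?thesis by blast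
qed

lemma card_edges_le_extremal_number:
  fixes G :: "'a graph"
  assumes G: "simple_graph G" "\<not> contains_copy G H"
  shows "card (edges G) \<le> extremal_number (card (verts G)) H"
proof -
  have fin: "finite (verts G)" and ed: "\<And>e. e \<in> edges G \<Longrightarrow> e \<subseteq> verts G \<and> card e = 2"
    using G by (auto simp: simple_graph_def)
  obtain g :: "'a \<Rightarrow> nat" where g: "inj_on g (verts G)"
    using fin finite_imp_inj_to_nat_seg by blast
  define G' where "G' = (g ` verts G, (`) g ` edges G)"
  have inj: "inj_on ((`) g) (edges G)"
    by (rule inj_on_subset[OF inj_on_image_Pow[OF g]]) (use ed in blast)
  have simple: "simple_graph G'"
    unfolding simple_graph_def G'_def
  proof (intro conjI ballI)
    fix e' assume "e' \<in> edges (g ` verts G, (`) g ` edges G)"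
    then obtain e where e: "e \<in> edges G" "e' = g ` e" by auto
    show "e' \<subseteq> verts (g ` verts G, (`) g ` edges G)"
      using ed[OF e(1)] e(2) by auto
    show "card e' = 2"
      using ed[OF e(1)] e(2) card_image[OF inj_on_subset[OF g]] by metis
  qed (simp add: fin)
  have "\<not> contains_copy G' H"
  proof
    assume "contains_copy G' H"
    then obtain f where f: "inj_on f (verts H)" "f ` verts H \<subseteq> g ` verts G"
      "\<And>e. e \<in> edges H \<Longrightarrow> f ` e \<in> (`) g ` edges G"
      by (auto simp: contains_copy_def G'_def)
    let ?h = "inv_into (verts G) g"
    have "inj_on (?h \<circ> f) (verts H)"
      using f by (intro comp_inj_on inj_on_inv_into)
    moreover have "(?h \<circ> f) ` verts H \<subseteq> verts G"
      using f(2) inv_into_into[of _ g "verts G"] by fastforce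
    moreover have "(?h \<circ> f) ` e \<in> edges G" if e: "e \<in> edges H" for e
    proof -
      obtain e' where e': "e' \<in> edges G" "f ` e = g ` e'" using f(3)[OF e] by blast
      have "(?h \<circ> f) ` e = ?h ` g ` e'" by (simp only: image_comp [symmetric] e'(2))
      also have "\<dots> = e'" using g ed[OF e'(1)] by (simp add: inv_into_image_cancel)
      finally show ?thesis using e' by simp
    qed
    ultimately have "contains_copy G H" unfolding contains_copy_def by blast
    with G show False by simp
  qed
  moreover have "card (verts G') = card (verts G)" "card (edges G') = card (edges G)"
    using g inj by (auto simp: G'_def card_image)
  ultimately have "card (edges G) \<in> {card (edges G') | G' :: nat graph.
      simple_graph G' \<and> card (verts G') = card (verts G) \<and> \<not> contains_copy G' H}"
    unfolding mem_Collect_eq using simple by (intro exI[of _ G']) simp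
  then show ?thesis
    unfolding extremal_number_def by (rule Max_ge[OF finite_edge_counts])
qed

lemma contains_C4_iff:
  assumes "simple_graph G"
  shows "contains_copy G (cycle_graph 4) \<longleftrightarrow>
    (\<exists>a b c d. distinct [a, b, c, d] \<and> {a, b} \<in> edges G \<and> {b, c} \<in> edges G
       \<and> {c, d} \<in> edges G \<and> {d, a} \<in> edges G)"
proof -
  have V: "verts (cycle_graph 4) = {0, 1, 2, 3}"
    by (auto simp: cycle_graph_def)
  have "edges (cycle_graph 4) = (\<lambda>i. {i, Suc i mod 4}) ` {..<4}"
    unfolding cycle_graph_def by auto
  also have "{..<4::nat} = {0, 1, 2, 3}" by auto
  also have "(\<lambda>i::nat. {i, Suc i mod 4}) ` {0, 1, 2, 3} = {{0, 1}, {1, 2}, {2, 3}, {3, 0}}"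
  proof -
    have "Suc 0 mod 4 = 1" "Suc 1 mod 4 = 2" "Suc 2 mod 4 = 3" "Suc 3 mod 4 = 0"
      by simp_all
    then show ?thesis
      by (simp only: image_insert image_empty)
  qed
  finally have E: "edges (cycle_graph 4) = {{0, 1}, {1, 2}, {2, 3}, {3, 0}}" .
  show ?thesis
  proof
    assume "contains_copy G (cycle_graph 4)"
    then obtain f where "inj_on f {0, 1, 2, 3::nat}"
      "\<forall>e\<in>{{0, 1}, {1, 2}, {2, 3}, {3, 0}}. f ` e \<in> edges G"
      unfolding contains_copy_def V E by blast
    then show "\<exists>a b c d. distinct [a, b, c, d] \<and> {a, b} \<in> edges G \<and> {b, c} \<in> edges G
       \<and> {c, d} \<in> edges G \<and> {d, a} \<in> edges G"
      by (intro exI[of _ "f 0"] exI[of _ "f 1"] exI[of _ "f 2"] exI[of _ "f 3"])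
         (auto simp: inj_on_def simp del: One_nat_def)
  next
    assume "\<exists>a b c d. distinct [a, b, c, d] \<and> {a, b} \<in> edges G \<and> {b, c} \<in> edges G
       \<and> {c, d} \<in> edges G \<and> {d, a} \<in> edges G"
    then obtain a b c d where *: "distinct [a, b, c, d]" "{a, b} \<in> edges G" "{b, c} \<in> edges G"
       "{c, d} \<in> edges G" "{d, a} \<in> edges G" by blast
    have V': "a \<in> verts G" "b \<in> verts G" "c \<in> verts G" "d \<in> verts G"
      using *(2-5) assms by (auto simp: simple_graph_def)
    define f where "f = (!) [a, b, c, d]"
    have f: "f 0 = a" "f 1 = b" "f 2 = c" "f 3 = d"
      by (simp_all add: f_def numeral_eq_Suc)
    have inj: "inj_on f {0, 1, 2, 3}"
      using *(1) f by (auto simp: inj_on_def)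
    show "contains_copy G (cycle_graph 4)"
      unfolding contains_copy_def V E
      using *(2-5) V' inj f by (intro exI[of _ f]) (simp del: One_nat_def)
  qed
qed

end

theory Submission
  imports Defs "HOL-Analysis.Analysis"
begin

text \<open>
  Let \<open>d\<close> be the degree function, \<open>Q = q + 1\<close>, and suppose that the degree sum is \<open>n Q + s\<close> with
  \<open>s > max 0 (r - 0.3 q) Q\<close>. Let \<open>P\<close> be the set of vertices of degree greater than \<open>Q\<close>, \<open>p = |P|\<close>,
  let \<open>Y \<ge> p\<close> be the total excess of their degrees over \<open>Q\<close>, let \<open>z\<close> be the deficiency
  \<open>max 0 (Q - d)\<close>, and let \<open>d\<^sub>P u\<close> be the number of neighbours of \<open>u\<close> in \<open>P\<close>. Two vertices have
  at most one common neighbour, so a vertex \<open>v\<close> satisfies \<open>\<Sum>u\<sim>v. (d u - 1) \<le> n - 1\<close>; summed over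
  \<open>P\<close> this says that the neighbours of \<open>P\<close> are deficient: \<open>\<Sum>u. z u * d\<^sub>P u \<ge> q Y - r p\<close>.
  On the other hand \<open>d\<^sub>P \<le> d\<close> bounds this sum by \<open>\<Sum>u. z u * (Q - z u)\<close>, so that \<open>z\<close> has a
  small second moment, while counting the common neighbours of pairs in \<open>P\<close> gives
  \<open>\<Sum>u. (d\<^sub>P u - c)\<^sup>2 \<le> Y (Q - 2 c)\<close> for \<open>c = p / Q\<close>. By Cauchy--Schwarz
  \<open>(0.7 q - c)\<^sup>2 \<le> (0.3 q + 1) (Q - 2 c)\<close>, which fails for large \<open>q\<close>.
\<close>

text \<open>Double counting of walks \<open>u\<close>, \<open>w\<close>, \<open>v\<close> with
  \<open>u\<close> in \<open>A\<close> and \<open>v\<close> in \<open>B\<close>. A pair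
  \<open>u \<noteq> v\<close> has at most one middle vertex, and the diagonal pair
  \<open>v = u\<close> contributes the degree of \<open>u\<close>. Since
  \<open>A \<subseteq> B\<close>, each \<open>u\<close> meets the diagonal exactly once, which
  leaves \<open>card B - 1\<close> other pairs.\<close>

lemma sum_nbrs_prod_le:
  fixes R :: "'a \<Rightarrow> 'a \<Rightarrow> bool"
  defines "a \<equiv> \<lambda>u v. of_bool (R u v) :: real"
  assumes fin: "finite V" and AB: "A \<subseteq> B" "B \<subseteq> V"
    and codeg: "\<And>u v. u \<in> V \<Longrightarrow> v \<in> V \<Longrightarrow> u \<noteq> v \<Longrightarrow> card {w \<in> V. R w u \<and> R w v} \<le> 1"
  shows "(\<Sum>w\<in>V. (\<Sum>u\<in>A. a w u) * (\<Sum>v\<in>B. a w v))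
           \<le> (\<Sum>u\<in>A. \<Sum>w\<in>V. a w u) + real (card A) * (real (card B) - 1)"
proof -
  have finB: "finite B" using fin AB finite_subset by blast
  have "(\<Sum>w\<in>V. (\<Sum>u\<in>A. a w u) * (\<Sum>v\<in>B. a w v))
      = (\<Sum>w\<in>V. \<Sum>u\<in>A. \<Sum>v\<in>B. a w u * a w v)"
    by (simp add: sum_product)
  also have "\<dots> = (\<Sum>u\<in>A. \<Sum>w\<in>V. \<Sum>v\<in>B. a w u * a w v)"
    by (rule sum.swap)
  also have "\<dots> = (\<Sum>u\<in>A. \<Sum>v\<in>B. \<Sum>w\<in>V. a w u * a w v)"
    by (rule sum.cong[OF refl]) (rule sum.swap)
  also have "\<dots> \<le> (\<Sum>u\<in>A. (\<Sum>w\<in>V. a w u) + (real (card B) - 1))"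
  proof (rule sum_mono)
    fix u assume u: "u \<in> A"
    have "(\<Sum>w\<in>V. a w u * a w v) \<le> 1" if "v \<in> B - {u}" for v
    proof -
      have "(\<Sum>w\<in>V. a w u * a w v) = real (card {w \<in> V. R w u \<and> R w v})"
        using fin by (simp add: a_def of_bool_conj[symmetric] Int_def)
      also have "\<dots> \<le> 1" using codeg[of u v] u that AB by force
      finally show ?thesis .
    qed
    then have "(\<Sum>v\<in>B - {u}. \<Sum>w\<in>V. a w u * a w v) \<le> (\<Sum>v\<in>B - {u}. 1)"
      by (intro sum_mono)
    moreover have "card B \<ge> 1" using finB u AB by (metis card_0_eq empty_iff less_one not_less subsetD)
    then have "(\<Sum>v\<in>B - {u}. 1) = real (card B) - 1"
      using finB u AB by (simp add: card_Diff_singleton subsetD of_nat_diff)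
    moreover have "(\<Sum>v\<in>B. \<Sum>w\<in>V. a w u * a w v)
        = (\<Sum>w\<in>V. a w u * a w u) + (\<Sum>v\<in>B - {u}. \<Sum>w\<in>V. a w u * a w v)"
      using finB u AB by (intro sum.remove) auto
    moreover have "(\<Sum>w\<in>V. a w u * a w u) = (\<Sum>w\<in>V. a w u)"
      by (intro sum.cong) (auto simp: a_def)
    ultimately show "(\<Sum>v\<in>B. \<Sum>w\<in>V. a w u * a w v) \<le> (\<Sum>w\<in>V. a w u) + (real (card B) - 1)"
      by linarith
  qed
  also have "\<dots> = (\<Sum>u\<in>A. \<Sum>w\<in>V. a w u) + real (card A) * (real (card B) - 1)"
    by (simp add: sum.distrib)
  finally show ?thesis .
qed

lemma degree_sum_le:
  fixes R :: "'a \<Rightarrow> 'a \<Rightarrow> bool" and q r :: nat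
  assumes fin: "finite V" and n: "card V = q\<^sup>2 + q + 1 + r" and rq: "r \<le> q" and q: "q \<ge> 99"
    and symR: "\<And>u v. R u v \<Longrightarrow> R v u"
    and codeg: "\<And>u v. u \<in> V \<Longrightarrow> v \<in> V \<Longrightarrow> u \<noteq> v \<Longrightarrow> card {w \<in> V. R w u \<and> R w v} \<le> 1"
  shows "real (\<Sum>v\<in>V. card {u \<in> V. R v u})
           \<le> (real q ^ 2 + real q + 1 + max (real r) (2 * real r - 0.3 * real q)) * (real q + 1)"
proof (rule ccontr)
  assume neg: "\<not> ?thesis"
  define a where "a = (\<lambda>u v. of_bool (R u v) :: real)"
  define Q where "Q = real q + 1"
  define d where "d = (\<lambda>v. real (card {u \<in> V. R v u}))"
  define P where "P = {v \<in> V. d v > Q}"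
  define dP where "dP = (\<lambda>u. \<Sum>v\<in>P. a u v)"
  define p where "p = real (card P)"
  define Y where "Y = (\<Sum>v\<in>P. d v - Q)"
  define z where "z = (\<lambda>v. max 0 (Q - d v))"
  define Z where "Z = (\<Sum>v\<in>V. z v)"
  define T where "T = (\<Sum>v\<in>V. (z v)\<^sup>2)"
  define L where "L = (\<Sum>v\<in>V. z v * dP v)"
  define N where "N = real (card V)"
  define s where "s = (\<Sum>v\<in>V. d v) - N * Q"
  define c where "c = p / Q"
  define W where "W = (\<Sum>v\<in>V. (dP v - c)\<^sup>2)"
  have Q: "Q > 0" by (simp add: Q_def)
  \<comment> \<open>The bound \<open>N \<le> Q^2\<close> is exactly the hypothesis
    \<open>r \<le> q\<close>.\<close>
  have N: "N = Q\<^sup>2 - q + r" "N \<le> Q\<^sup>2"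
    using rq by (simp_all add: N_def n Q_def power2_eq_square algebra_simps)
  have asym: "a u v = a v u" for u v using symR by (auto simp: a_def)
  have d_a: "d v = (\<Sum>u\<in>V. a v u)" for v
    using fin by (simp add: d_def a_def Int_def)
  have PV: "P \<subseteq> V" and finP: "finite P" using fin by (auto simp: P_def)
  \<comment> \<open>Here \<open>max r (2r - 0.3q) = r + max 0 (r - 0.3q)\<close>, and the first
    summand is absorbed in \<open>N * Q\<close>.\<close>
  have s: "s > 0" "s > (r - 0.3 * q) * Q"
  proof -
    have "(\<Sum>v\<in>V. d v) > (real q ^ 2 + q + 1 + max (real r) (2 * r - 0.3 * q)) * Q"
      using neg by (simp add: d_def Q_def)
    also have "(real q ^ 2 + q + 1 + max (real r) (2 * r - 0.3 * q)) * Q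
        = N * Q + max 0 (r - 0.3 * q) * Q"
      by (simp add: N_def n max_def algebra_simps)
    finally have "s > max 0 (r - 0.3 * q) * Q" by (simp add: s_def)
    moreover have "max 0 (r - 0.3 * q) * Q \<ge> 0 * Q" "max 0 (r - 0.3 * q) * Q \<ge> (r - 0.3 * q) * Q"
      using Q by (intro mult_right_mono; simp)+
    ultimately show "s > 0" "s > (r - 0.3 * q) * Q" by linarith+
  qed
  \<comment> \<open>Degrees are integers, so a degree above \<open>Q\<close> exceeds it by at least
    1.\<close>
  have pY: "p \<le> Y"
  proof -
    have "d v - Q \<ge> 1" if "v \<in> P" for v
    proof -
      have "real (q + 1) < real (card {u \<in> V. R v u})"
        using that by (simp add: P_def Q_def d_def)
      then have "q + 2 \<le> card {u \<in> V. R v u}" by linarith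
      then have "real (q + 2) \<le> real (card {u \<in> V. R v u})" by (rule of_nat_mono)
      then show ?thesis by (simp add: d_def Q_def)
    qed
    then have "(\<Sum>v\<in>P. 1) \<le> Y" unfolding Y_def by (intro sum_mono)
    then show ?thesis by (simp add: p_def)
  qed
  have pN: "p \<le> N" using fin PV by (simp add: p_def N_def card_mono)
  have ZY: "Z = Y - s"
  proof -
    have "z v = Q - d v + (if v \<in> P then d v - Q else 0)" if "v \<in> V" for v
      using that by (auto simp: z_def P_def)
    then have "Z = (\<Sum>v\<in>V. Q - d v + (if v \<in> P then d v - Q else 0))"
      unfolding Z_def by simp
    also have "\<dots> = (\<Sum>v\<in>V. Q - d v) + (\<Sum>v\<in>V \<inter> P. d v - Q)"
      using fin by (simp add: sum.distrib sum.inter_restrict)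
    also have "V \<inter> P = P" using PV by blast
    finally show ?thesis by (simp add: Y_def s_def N_def sum_subtractf)
  qed
  have Z0: "Z \<ge> 0" by (simp add: Z_def z_def sum_nonneg)
  have Ypos: "Y > 0" using ZY Z0 s by linarith
  have D: "(\<Sum>v\<in>P. d v) = p * Q + Y"
    by (simp add: Y_def p_def sum_subtractf)
  have sum_dP: "(\<Sum>u\<in>V. dP u) = p * Q + Y"
  proof -
    have "(\<Sum>u\<in>V. dP u) = (\<Sum>v\<in>P. \<Sum>u\<in>V. a u v)"
      unfolding dP_def by (rule sum.swap)
    also have "\<dots> = (\<Sum>v\<in>P. d v)"
      unfolding d_a by (simp add: asym)
    finally show ?thesis using D by simp
  qed
  have D': "(\<Sum>v\<in>P. \<Sum>u\<in>V. a u v) = p * Q + Y"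
    using sum_dP unfolding dP_def by (subst (asm) sum.swap)
  \<comment> \<open>Walks from \<open>P\<close> to \<open>V\<close>; the next fact counts those from
    \<open>P\<close> to \<open>P\<close>.\<close>
  have dP_d: "(\<Sum>u\<in>V. dP u * d u) \<le> p * Q + Y + p * (N - 1)"
    using sum_nbrs_prod_le[where R = R, OF fin PV subset_refl codeg] D'
    by (simp add: dP_def d_a p_def N_def a_def)
  have dP_sq: "(\<Sum>u\<in>V. (dP u)\<^sup>2) \<le> p * Q + Y + p * (p - 1)"
    using sum_nbrs_prod_le[where R = R, OF fin subset_refl PV codeg] D'
    by (simp add: dP_def p_def a_def power2_eq_square)
  have L_lower: "L \<ge> q * Y - r * p"
  proof -
    have "q * Y - r * p = Q * (p * Q + Y) - (p * Q + Y + p * (N - 1))"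
      by (simp add: N Q_def power2_eq_square algebra_simps)
    also have "\<dots> \<le> Q * (p * Q + Y) - (\<Sum>u\<in>V. dP u * d u)" using dP_d by simp
    also have "\<dots> = (\<Sum>u\<in>V. dP u * (Q - d u))"
      unfolding sum_dP[symmetric] by (simp add: sum_distrib_left sum_subtractf algebra_simps)
    \<comment> \<open>Vertices of degree above \<open>Q\<close> contribute nonpositive terms, which
      \<open>z\<close> replaces by 0.\<close>
    also have "\<dots> \<le> L"
      unfolding L_def
    proof (rule sum_mono)
      fix u
      have "dP u \<ge> 0" by (simp add: dP_def a_def sum_nonneg)
      then show "dP u * (Q - d u) \<le> z u * dP u"
        by (subst mult.commute) (simp add: z_def mult_right_mono)
    qed
    finally show ?thesis .
  qed
  have T_le: "T \<le> Q * Z - L"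
  proof -
    have "z u * dP u \<le> Q * z u - (z u)\<^sup>2" for u
    proof (cases "d u < Q")
      case True
      have "dP u \<le> d u"
        unfolding dP_def d_a using fin PV by (intro sum_mono2) (auto simp: a_def)
      then have "z u * dP u \<le> z u * d u" by (simp add: z_def mult_left_mono)
      also have "\<dots> = Q * z u - (z u)\<^sup>2"
        using True by (simp add: z_def power2_eq_square algebra_simps)
      finally show ?thesis .
    qed (simp add: z_def)
    then have "L \<le> (\<Sum>u\<in>V. Q * z u - (z u)\<^sup>2)" unfolding L_def by (intro sum_mono)
    also have "\<dots> = Q * Z - T" by (simp add: sum_subtractf Z_def T_def sum_distrib_left)
    finally show ?thesis by simp
  qed
  have c0: "c \<ge> 0" and cQ: "c * Q = p" using Q by (simp_all add: c_def p_def)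
  \<comment> \<open>With \<open>c * Q = p\<close> and \<open>N * c^2 \<le> p^2\<close>, all terms in
    \<open>p^2\<close> cancel; this dictates the choice of \<open>c\<close>.\<close>
  have W_le: "W \<le> Y * (Q - 2 * c)"
  proof -
    have "W = (\<Sum>u\<in>V. (dP u)\<^sup>2) - 2 * c * (\<Sum>u\<in>V. dP u) + N * c\<^sup>2"
    proof -
      have "W = (\<Sum>u\<in>V. (dP u)\<^sup>2 - 2 * c * dP u + c\<^sup>2)"
        unfolding W_def by (simp add: power2_diff algebra_simps)
      then show ?thesis by (simp add: sum.distrib sum_subtractf sum_distrib_left N_def)
    qed
    also have "\<dots> \<le> (p * Q + Y + p * (p - 1)) - 2 * c * (p * Q + Y) + Q\<^sup>2 * c\<^sup>2"
      using dP_sq mult_right_mono[OF N(2), of "c\<^sup>2"] by (simp add: sum_dP)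
    also have "\<dots> = p * q + Y - 2 * c * Y"
      unfolding cQ[symmetric] by (simp add: Q_def power2_eq_square algebra_simps)
    also have "\<dots> \<le> Y * q + Y - 2 * c * Y" using pY by (simp add: mult_right_mono)
    finally show ?thesis by (simp add: Q_def algebra_simps)
  qed
  have W0: "W \<ge> 0" by (simp add: W_def sum_nonneg)
  \<comment> \<open>A sum of squares is nonnegative. The bound keeps \<open>0.7q - c\<close>
    nonnegative, so that \<open>B\<close> below can be squared.\<close>
  have c_le: "2 * c \<le> Q"
    using order_trans[OF W0 W_le] Ypos by (simp add: zero_le_mult_iff)
  have T_Y: "T \<le> Y * (0.3 * q + 1)"
  proof -
    have "T \<le> Y + (r * p - Q * s)"
      using T_le L_lower unfolding ZY by (simp add: Q_def algebra_simps)
    also have "r * p - Q * s \<le> 0.3 * q * p"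
    \<comment> \<open>For large \<open>r\<close> the surplus \<open>s\<close> pays for
      \<open>(r - 0.3q) * p\<close>, because \<open>p \<le> Q^2\<close>; for small \<open>r\<close>
      its sign suffices.\<close>
    proof (cases "r - 0.3 * q \<ge> 0")
      case True
      have "(r - 0.3 * q) * p \<le> (r - 0.3 * q) * Q\<^sup>2"
        using True pN N(2) by (intro mult_left_mono) auto
      also have "\<dots> = Q * ((r - 0.3 * q) * Q)" by (simp add: power2_eq_square)
      also have "\<dots> \<le> Q * s" using s Q by (intro mult_left_mono) auto
      finally show ?thesis by (simp add: algebra_simps)
    next
      case False
      then have "r * p \<le> 0.3 * q * p" by (intro mult_right_mono) (auto simp: p_def)
      moreover have "Q * s \<ge> 0" using Q s by simp
      ultimately show ?thesis by linarith
    qed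
    also have "0.3 * q * p \<le> 0.3 * q * Y" using pY by (intro mult_left_mono) auto
    finally show ?thesis by (simp add: algebra_simps)
  qed
  \<comment> \<open>Substituting \<open>Z = Y - s\<close> leaves \<open>r * p - c * s\<close> to
    bound; since \<open>c * Q = p\<close>, the lower bound on \<open>s\<close> turns
    \<open>c * s\<close> into at least \<open>(r - 0.3q) * p\<close>, whatever the sign of
    \<open>r - 0.3q\<close>.\<close>
  have B: "Y * (0.7 * q - c) \<le> L - c * Z"
  proof -
    have "r * p - c * s \<le> 0.3 * q * p"
    proof -
      have "c * ((r - 0.3 * q) * Q) \<le> c * s" using s c0 by (intro mult_left_mono) auto
      then show ?thesis unfolding cQ[symmetric] by (simp add: algebra_simps)
    qed
    also have "0.3 * q * p \<le> 0.3 * q * Y" using pY by (intro mult_left_mono) auto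
    finally show ?thesis using L_lower unfolding ZY by (simp add: algebra_simps)
  qed
  have "(Y * (0.7 * q - c))\<^sup>2 \<le> (L - c * Z)\<^sup>2"
    using B Ypos c_le q by (intro power_mono mult_nonneg_nonneg) (auto simp: Q_def)
  also have "L - c * Z = (\<Sum>u\<in>V. z u * (dP u - c))"
    by (simp add: L_def Z_def sum_subtractf sum_distrib_left algebra_simps)
  also have "\<dots>\<^sup>2 \<le> T * W"
    unfolding T_def W_def by (rule Cauchy_Schwarz_ineq_sum)
  also have "\<dots> \<le> (Y * (0.3 * q + 1)) * (Y * (Q - 2 * c))"
    using T_Y W_le W0 Ypos by (intro mult_mono) auto
  also have "\<dots> = Y\<^sup>2 * ((0.3 * q + 1) * (Q - 2 * c))" by (simp add: power2_eq_square)
  finally have "(0.7 * q - c)\<^sup>2 \<le> (0.3 * q + 1) * (Q - 2 * c)"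
    using Ypos by (simp add: power_mult_distrib)
  \<comment> \<open>Completing the square in \<open>c\<close> leaves the leading coefficient
    \<open>0.03 = 0.3 * (1 - 3 * 0.3)\<close>, positive because \<open>0.3 < 1/3\<close>.\<close>
  moreover have "(0.7 * q - c)\<^sup>2 - (0.3 * q + 1) * (Q - 2 * c)
      = (c - 0.4 * q)\<^sup>2 + (0.03 * q - 1.3) * q + 2 * c - 1"
    by (simp add: Q_def power2_eq_square field_simps)
  moreover have "(0.03 * q - 1.3) * q \<ge> 1.6 * 99"
    using q by (intro mult_mono) auto
  ultimately show False using c0 zero_le_power2[of "c - 0.4 * q"] by linarith
qed

lemma sum_degrees_eq:
  assumes "simple_graph G"
  shows "(\<Sum>v\<in>verts G. card {u \<in> verts G. {v, u} \<in> edges G}) = 2 * card (edges G)"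
proof -
  have fin: "finite (verts G)" and ed: "\<And>e. e \<in> edges G \<Longrightarrow> e \<subseteq> verts G \<and> card e = 2"
    using assms by (auto simp: simple_graph_def)
  have finE: "finite (edges G)"
    by (rule finite_subset[of _ "Pow (verts G)"]) (use fin ed in blast)+
  have deg: "card {u \<in> verts G. {v, u} \<in> edges G} = card {e \<in> edges G. v \<in> e}" for v
  proof (rule bij_betw_same_card[of "\<lambda>u. {v, u}"])
    show "bij_betw (\<lambda>u. {v, u}) {u \<in> verts G. {v, u} \<in> edges G} {e \<in> edges G. v \<in> e}"
      proof (rule bij_betw_imageI)
      show "inj_on (\<lambda>u. {v, u}) {u \<in> verts G. {v, u} \<in> edges G}"
        by (simp add: inj_on_def doubleton_eq_iff)
      show "(\<lambda>u. {v, u}) ` {u \<in> verts G. {v, u} \<in> edges G} = {e \<in> edges G. v \<in> e}"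
      proof (intro subset_antisym subsetI)
        fix e assume e: "e \<in> {e \<in> edges G. v \<in> e}"
        then have "e \<subseteq> verts G" "card e = 2" "v \<in> e" using ed by blast+
        then obtain u where u: "e = {v, u}" unfolding card_2_iff by blast
        then have "u \<in> {u \<in> verts G. {v, u} \<in> edges G}" using e \<open>e \<subseteq> verts G\<close> by blast
        with u show "e \<in> (\<lambda>u. {v, u}) ` {u \<in> verts G. {v, u} \<in> edges G}" by blast
      qed blast
    qed
  qed
  have "(\<Sum>v\<in>verts G. card {e \<in> edges G. v \<in> e}) = (\<Sum>e\<in>edges G. card {v \<in> verts G. v \<in> e})"
    using sum.swap_restrict[OF fin finE, of "\<lambda>_ _. 1::nat" "\<lambda>v e. v \<in> e"] by simp
  also have "\<dots> = (\<Sum>e\<in>edges G. 2)"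
  proof (rule sum.cong[OF refl])
    fix e assume e: "e \<in> edges G"
    have "{v \<in> verts G. v \<in> e} = e" using ed[OF e] by blast
    then show "card {v \<in> verts G. v \<in> e} = 2" using ed[OF e] by simp
  qed
  finally show ?thesis by (simp add: deg)
qed

text \<open>Two distinct common neighbours \<open>w\<close>, \<open>w'\<close> would close the
  4-cycle \<open>u\<close>, \<open>w\<close>, \<open>v\<close>, \<open>w'\<close>; its vertices are
  distinct because there are no loops.\<close>

lemma codegree_le_1:
  assumes G: "simple_graph G" "\<not> contains_copy G (cycle_graph 4)" and uv: "u \<noteq> v"
  shows "card {w \<in> verts G. {w, u} \<in> edges G \<and> {w, v} \<in> edges G} \<le> 1"
proof -
  have loop: "{x} \<notin> edges G" for x using G(1) by (auto simp: simple_graph_def)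
  have "w = w'" if "{w, u} \<in> edges G" "{w, v} \<in> edges G" "{w', u} \<in> edges G" "{w', v} \<in> edges G" for w w'
  proof (rule ccontr)
    assume "w \<noteq> w'"
    then have "distinct [u, w, v, w']" using uv that loop by auto
    moreover have "{u, w} \<in> edges G" "{w, v} \<in> edges G" "{v, w'} \<in> edges G" "{w', u} \<in> edges G"
      using that by (simp_all add: insert_commute)
    ultimately show False using G contains_C4_iff[OF G(1)] by blast
  qed
  moreover have "finite (verts G)" using G by (simp add: simple_graph_def)
  ultimately show ?thesis by (auto simp: card_le_Suc0_iff_eq)
qed

theorem theorem1p5:
  shows "\<exists>N\<^sub>0::nat. \<forall>(q::nat) (r::nat) (n::nat).
    q \<ge> 1 \<and> 1 \<le> r \<and> real r \<le> 0.6 * real q \<and> n = q ^ 2 + q + 1 + r \<and> n \<ge> N\<^sub>0 \<longrightarrow>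
    real (extremal_number n (cycle_graph 4))
      \<le> 1 / 2 * (real q ^ 2 + real q + 1 + max (real r) (2 * real r - 0.3 * real q)) * (real q + 1)"
\<comment> \<open>If \<open>q \<le> 98\<close> and \<open>r \<le> q\<close>, then
  \<open>n \<le> (q + 1)^2 \<le> 9801\<close>, so this threshold forces
  \<open>q \<ge> 99\<close>.\<close>
proof (intro exI[of _ 10000] allI impI)
  fix q r n :: nat
  assume A: "q \<ge> 1 \<and> 1 \<le> r \<and> real r \<le> 0.6 * real q \<and> n = q ^ 2 + q + 1 + r \<and> n \<ge> 10000"
  then have rq: "r \<le> q" by linarith
  have q: "q \<ge> 99"
  proof (rule ccontr)
    assume "\<not> q \<ge> 99"
    then have "q \<le> 98" by simp
    then have "q\<^sup>2 \<le> 98\<^sup>2" by (intro power_mono) auto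
    then show False using A rq \<open>q \<le> 98\<close> by simp
  qed
  \<comment> \<open>An edge in the cycle makes the set of edge counts nonempty, so its maximum is
    attained by some graph.\<close>
  have "{0, 1} \<in> edges (cycle_graph 4)"
    by (auto simp: cycle_graph_def intro!: exI[of _ 0])
  then have ne: "edges (cycle_graph 4) \<noteq> {}" by blast
  have "extremal_number n (cycle_graph 4) \<in> {card (edges G) | G :: nat graph.
            simple_graph G \<and> card (verts G) = n \<and> \<not> contains_copy G (cycle_graph 4)}"
    unfolding extremal_number_def by (rule Max_in[OF finite_edge_counts edge_counts_nonempty[OF ne]])
  then obtain G :: "nat graph" where G: "simple_graph G" "card (verts G) = n"
      "\<not> contains_copy G (cycle_graph 4)" "extremal_number n (cycle_graph 4) = card (edges G)"
    by auto
  have "real (\<Sum>v\<in>verts G. card {u \<in> verts G. {v, u} \<in> edges G})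
      \<le> (real q ^ 2 + real q + 1 + max (real r) (2 * real r - 0.3 * real q)) * (real q + 1)"
  proof (rule degree_sum_le[OF _ _ rq q])
    show "finite (verts G)" using G(1) by (simp add: simple_graph_def)
    show "card (verts G) = q\<^sup>2 + q + 1 + r" using G(2) A by simp
    show "{u, v} \<in> edges G \<Longrightarrow> {v, u} \<in> edges G" for u v by (simp add: insert_commute)
    show "u \<noteq> v \<Longrightarrow> card {w \<in> verts G. {w, u} \<in> edges G \<and> {w, v} \<in> edges G} \<le> 1" for u v
      by (rule codegree_le_1[OF G(1,3)])
  qed
  then show "real (extremal_number n (cycle_graph 4))
      \<le> 1 / 2 * (real q ^ 2 + real q + 1 + max (real r) (2 * real r - 0.3 * real q)) * (real q + 1)"
    unfolding sum_degrees_eq[OF G(1)] G(4) by simp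
qed

end
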